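(* Let $\mathcal{X}$ be a finite alphabet. The type-based coding scheme $(\phi_n,\psi_n)$ described in the context, with parameters $\alpha>\beta>1$, provides a sequence of $(n,2^{d_n})$ variable-length universal uniform source codes such that, for any discrete memoryless source $(\mathcal{X},p_X)$ with unknown distribution $p_X$: 1. $\operatorname{p-lim}_{n\to\infty}\dfrac{m(X^n)}{n}\leq H(X)$; 2. $d_n=\Theta(\log n)$; 3. $\mathbb{P}[X^n\neq\psi_n(\phi_n(X^n,U_{d_n}),U_{d_n})]=0$; 4. $\lim_{n\to\infty}\mathbb{D}\big(p_{\phi_n(X^n,U_{d_n})}\,\Vert\,p_{U_{M_n(X^n)}}\big)=0$.
   Context: Logarithms are in base 2. $X^n$ is a sequence of $n$ i.i.d. symbols with distribution $p_X$; $H(X)$ is the Shannon entropy of $p_X$; $\mathbb{D}(\cdot\Vert\cdot)$ is the Kullback-Leibler divergence; $\operatorname{p-lim}$ denotes limit in probability. $f(n)=\Theta(g(n))$ means $\liminf_{n\to\infty} f(n)/g(n)>0$ and $\limsup_{n\to\infty} f(n)/g(n)<\infty$. Universal uniform source code. An $(n,2^{d_n})$ variable-length universal uniform source code consists of a seed $U_{d_n}$, uniform on a set $\mathcal{U}_{d_n}$ of $2^{d_n}$ elements, independent of all other random variables and shared by encoder and decoder; an encoding function $\phi_n:\mathcal{X}^n\times\mathcal{U}_{d_n}\to\{0,1\}^m$; and a decoding function $\psi_n:\{0,1\}^m\times\mathcal{U}_{d_n}\to\mathcal{X}^n$. The functions $\phi_n,\psi_n$ do not depend on prior knowledge about $p_X$,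 but may depend on the realization of the source sequence; $m=m(X^n)$ is a random variable that is a function of $X^n$. Let $M_n(X^n)=2^{m(X^n)}$, and let $p_{U_{M_n(X^n)}}$ be the uniform distribution over a set of $M_n(X^n)$ elements (for the scheme below, over $\{0,\dots,c_n(X^n)-1\}\times\{0,\dots,2^{\gamma_n}-1\}$). $p_{\phi_n(X^n,U_{d_n})}$ is the distribution of the encoder output; the divergence in item 4 is a random variable, since the length $m(X^n)$ of the encoder output is itself a random variable. Types. The type of $x^n\in\mathcal{X}^n$ is its empirical distribution; $\mathcal{P}_n(\mathcal{X})$ is the set of all types of sequences in $\mathcal{X}^n$; $T^n_{\bar X}$ is the set of $x^n$ with type $p_{\bar X}\in\mathcal{P}_n(\mathcal{X})$. Coding scheme. Consider $\alpha,\beta$ with $\alpha>\beta>1$. Let $\gamma_n=\lceil|\mathcal{X}|\log(n+1)\rceil$ and $a_n=2^{\lceil\alpha\log n\rceil}$. The seed is a pair $(u_1,u_2)\in\mathcal{U}_{d_n}=\{0,\dots,a_n-1\}\times\{0,\dots,2^{\gamma_n}-1\}$, of length $d_n=\gamma_n+\lceil\alpha\log n\rceil$. For a type $p_{\bar X}\in\mathcal{P}_n(\mathcal{X})$ let $$c_n(p_{\bar X})=2^{\lceil\log|T^n_{\bar X}|+\beta\log n\rceil},\quad b_n(p_{\bar X})=\left\lfloor\frac{c_n(p_{\bar X})}{|T^n_{\bar X}|}\right\rfloor,\quad v_n(p_{\bar X})=u_1 \bmod b_n(p_{\bar X}),$$ and write $c_n(x^n)$ for $c_n$ evaluated at the type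 of $x^n$. Let $s:\mathcal{P}_n(\mathcal{X})\to\{0,\dots,2^{\gamma_n}-1\}$ be an arbitrary injective mapping and, for each type, let $k_{s(p_{\bar X})}:T^n_{\bar X}\to\{0,\dots,|T^n_{\bar X}|-1\}$ be an arbitrary one-to-one mapping. For $x^n\in T^n_{\bar X}$ the encoder outputs $\phi_n(x^n,(u_1,u_2))=(\phi_n^{(1)}(x^n,u_1),\phi_n^{(2)}(x^n,u_2))\in\{0,\dots,c_n(x^n)-1\}\times\{0,\dots,2^{\gamma_n}-1\}$ with $$\phi_n^{(1)}(x^n,u_1)=k_{s(p_{\bar X})}(x^n)+v_n(p_{\bar X})|T^n_{\bar X}|,\qquad \phi_n^{(2)}(x^n,u_2)=s(p_{\bar X})\oplus u_2,$$ where $\oplus$ is modulo-2 addition of binary representations. The output is viewed as a binary string of length $m(x^n)=\log(c_n(x^n)\,2^{\gamma_n})$. On input $(i,j,(u_1,u_2))$ the decoder outputs $k_{u_2\oplus j}^{-1}\big(i-v_n(p_{\bar X})|T^n_{\bar X}|\big)$, where $p_{\bar X}$ is the type with index $u_2\oplus j$. *)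

theory Defs
  imports "HOL-Probability.Probability"
begin

text \<open>
  The alphabet is a finite type; a block in \<open>X^n\<close> is a list of length \<open>n\<close>. All logarithms
  are to base 2. Only block lengths \<open>n \<ge> 1\<close> are meaningful below.
\<close>

definition blocks :: "nat \<Rightarrow> 'a list set" where
  "blocks n = {x. length x = n}"

subsection \<open>Variable-length universal uniform source codes\<close>

text \<open>
  \<open>U\<close> is the seed set and \<open>m x\<close> the length of the encoder output on the block \<open>x\<close>.
  Instead of literal bit strings, \<open>W x\<close> is a set of \<open>2^(m x)\<close> elements standing for
  \<open>{0,1}^(m x)\<close>; it depends on \<open>x\<close> through the length only. That \<open>\<phi>\<close> and \<open>\<psi>\<close> do not depend
  on the source distribution is expressed by no distribution occurring here. The decoder is
  constrained on actual encoder outputs only.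
\<close>

definition uniform_source_code ::
  "nat \<Rightarrow> nat \<Rightarrow> 'u set \<Rightarrow> ('a list \<Rightarrow> real) \<Rightarrow> ('a list \<Rightarrow> 'w set) \<Rightarrow>
   ('a list \<Rightarrow> 'u \<Rightarrow> 'w) \<Rightarrow> ('w \<Rightarrow> 'u \<Rightarrow> 'a list) \<Rightarrow> bool" where
  "uniform_source_code n d U m W \<phi> \<psi> \<longleftrightarrow>
     finite U \<and> card U = 2 ^ d \<and>
     (\<forall>x\<in>blocks n. \<exists>l::nat. m x = real l \<and> finite (W x) \<and> card (W x) = 2 ^ l) \<and>
     (\<forall>x\<in>blocks n. \<forall>y\<in>blocks n. m x = m y \<longrightarrow> W x = W y) \<and>
     (\<forall>x\<in>blocks n. \<forall>u\<in>U. \<phi> x u \<in> W x \<and> \<psi> (\<phi> x u) u \<in> blocks n)"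

subsection \<open>Types\<close>

definition type_of_block :: "'a list \<Rightarrow> 'a pmf" where
  "type_of_block x = pmf_of_multiset (mset x)"

definition types :: "nat \<Rightarrow> 'a pmf set" where
  "types n = type_of_block ` blocks n"

definition type_cls :: "nat \<Rightarrow> 'a pmf \<Rightarrow> 'a list set" where
  "type_cls n P = {x \<in> blocks n. type_of_block x = P}"

subsection \<open>The type-based coding scheme\<close>

text \<open>In \<open>gamma_len\<close>, \<open>seeds\<close> and \<open>seed_len\<close>, \<open>q\<close> is the size of the alphabet.\<close>

definition gamma_len :: "nat \<Rightarrow> nat \<Rightarrow> nat" where
  "gamma_len q n = nat \<lceil>real q * log 2 (real (n + 1))\<rceil>"

definition a_size :: "real \<Rightarrow> nat \<Rightarrow> nat" where
  "a_size \<alpha> n = 2 ^ nat \<lceil>\<alpha> * log 2 (real n)\<rceil>"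

definition seeds :: "real \<Rightarrow> nat \<Rightarrow> nat \<Rightarrow> (nat \<times> nat) set" where
  "seeds \<alpha> q n = {..<a_size \<alpha> n} \<times> {..<2 ^ gamma_len q n}"

definition seed_len :: "real \<Rightarrow> nat \<Rightarrow> nat \<Rightarrow> nat" where
  "seed_len \<alpha> q n = gamma_len q n + nat \<lceil>\<alpha> * log 2 (real n)\<rceil>"

definition c_size :: "real \<Rightarrow> nat \<Rightarrow> 'a pmf \<Rightarrow> nat" where
  "c_size \<beta> n P = 2 ^ nat \<lceil>log 2 (real (card (type_cls n P))) + \<beta> * log 2 (real n)\<rceil>"

definition b_size :: "real \<Rightarrow> nat \<Rightarrow> 'a pmf \<Rightarrow> nat" where
  "b_size \<beta> n P = nat \<lfloor>real (c_size \<beta> n P) / real (card (type_cls n P))\<rfloor>"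

definition v_idx :: "real \<Rightarrow> nat \<Rightarrow> 'a pmf \<Rightarrow> nat \<Rightarrow> nat" where
  "v_idx \<beta> n P u1 = u1 mod b_size \<beta> n P"

text \<open>\<open>s n\<close> indexes the types of \<open>blocks n\<close>; \<open>k n i\<close> enumerates the type class with index \<open>i\<close>.\<close>

definition encode ::
  "real \<Rightarrow> (nat \<Rightarrow> 'a pmf \<Rightarrow> nat) \<Rightarrow> (nat \<Rightarrow> nat \<Rightarrow> 'a list \<Rightarrow> nat) \<Rightarrow> nat \<Rightarrow>
   'a list \<Rightarrow> nat \<times> nat \<Rightarrow> nat \<times> nat" where
  "encode \<beta> s k n x u =
     (let P = type_of_block x in
      (k n (s n P) x + v_idx \<beta> n P (fst u) * card (type_cls n P), xor (s n P) (snd u)))"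

definition decode ::
  "real \<Rightarrow> (nat \<Rightarrow> 'a pmf \<Rightarrow> nat) \<Rightarrow> (nat \<Rightarrow> nat \<Rightarrow> 'a list \<Rightarrow> nat) \<Rightarrow> nat \<Rightarrow>
   nat \<times> nat \<Rightarrow> nat \<times> nat \<Rightarrow> 'a list" where
  "decode \<beta> s k n w u =
     (let t = xor (snd u) (snd w); P = inv_into (types n) (s n) t in
      inv_into (type_cls n P) (k n t)
        (fst w - v_idx \<beta> n P (fst u) * card (type_cls n P)))"

definition outputs :: "real \<Rightarrow> nat \<Rightarrow> 'a::finite list \<Rightarrow> (nat \<times> nat) set" where
  "outputs \<beta> n x =
     {..<c_size \<beta> n (type_of_block x)} \<times> {..<2 ^ gamma_len CARD('a) n}"

definition out_len :: "real \<Rightarrow> nat \<Rightarrow> 'a::finite list \<Rightarrow> real" where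
  "out_len \<beta> n x =
     log 2 (real (c_size \<beta> n (type_of_block x)) * 2 ^ gamma_len CARD('a) n)"

subsection \<open>Source, seed and information measures\<close>

definition source_entropy :: "'a pmf \<Rightarrow> real" where
  "source_entropy p = prob_space.entropy (measure_pmf p) 2 (count_space UNIV) (\<lambda>x. x)"

text \<open>Joint law of \<open>(X^n, U)\<close>: i.i.d. source symbols and an independent uniform seed.\<close>

definition source_seed_pmf :: "real \<Rightarrow> nat \<Rightarrow> 'a::finite pmf \<Rightarrow> ('a list \<times> (nat \<times> nat)) pmf"
  where "source_seed_pmf \<alpha> n p =
     pair_pmf (replicate_pmf n p) (pmf_of_set (seeds \<alpha> CARD('a) n))"

text \<open>
  Law of the encoder output given that its length is the one realized by \<open>x\<close>. As a function
  of the random block, this is the distribution of a string of length \<open>m(X^n)\<close>, so that it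
  can be compared with the uniform distribution on strings of that length. The conditioning
  event has positive probability when \<open>x\<close> is in the support of the source.
\<close>

definition output_pmf ::
  "real \<Rightarrow> real \<Rightarrow> (nat \<Rightarrow> 'a::finite pmf \<Rightarrow> nat) \<Rightarrow> (nat \<Rightarrow> nat \<Rightarrow> 'a list \<Rightarrow> nat) \<Rightarrow> nat \<Rightarrow>
   'a pmf \<Rightarrow> 'a list \<Rightarrow> (nat \<times> nat) pmf" where
  "output_pmf \<alpha> \<beta> s k n p x =
     map_pmf (\<lambda>(y, u). encode \<beta> s k n y u)
       (cond_pmf (source_seed_pmf \<alpha> n p) {(y, u). out_len \<beta> n y = out_len \<beta> n x})"

text \<open>
  The library's \<open>KL_divergence b M N\<close> is the divergence of \<open>N\<close> from \<open>M\<close>, i.e. \<open>D(N || M)\<close>;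
  it is meaningful only if \<open>N\<close> is absolutely continuous with respect to \<open>M\<close>, which holds
  here when all encoder outputs of a given length lie in the corresponding set \<open>outputs\<close>,
  as \<open>uniform_source_code\<close> demands.
\<close>

definition output_divergence ::
  "real \<Rightarrow> real \<Rightarrow> (nat \<Rightarrow> 'a::finite pmf \<Rightarrow> nat) \<Rightarrow> (nat \<Rightarrow> nat \<Rightarrow> 'a list \<Rightarrow> nat) \<Rightarrow> nat \<Rightarrow>
   'a pmf \<Rightarrow> 'a list \<Rightarrow> real" where
  "output_divergence \<alpha> \<beta> s k n p x =
     KL_divergence 2 (measure_pmf (pmf_of_set (outputs \<beta> n x)))
       (measure_pmf (output_pmf \<alpha> \<beta> s k n p x))"

text \<open>
  \<open>Z n\<close> is a random variable on the probability space \<open>M n\<close>; the spaces may vary with \<open>n\<close>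
  since the limit is a constant.
\<close>

definition p_lim :: "(nat \<Rightarrow> 'b pmf) \<Rightarrow> (nat \<Rightarrow> 'b \<Rightarrow> real) \<Rightarrow> real \<Rightarrow> bool" where
  "p_lim M Z L \<longleftrightarrow>
     (\<forall>\<epsilon>>0. (\<lambda>n. measure_pmf.prob (M n) {\<omega>. \<bar>Z n \<omega> - L\<bar> > \<epsilon>}) \<longlonglongrightarrow> 0)"

end

theory Submission
  imports Defs "HOL-Real_Asymp.Real_Asymp"
begin

text \<open>
  Let \<open>T\<close> be the type class of \<open>x\<close>. The output length is \<open>log |T| + O(log n)\<close>, and since \<open>p\<^sup>n\<close> is
  constant on \<open>T\<close>, \<open>log |T| = log p\<^sup>n(T) - log p\<^sup>n(x)\<close>. There are at most polynomially many types,
  so with high probability the first term is of order \<open>log n\<close>, while the second one, divided by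
  \<open>n\<close>, tends to the entropy by the weak law of large numbers. The rate thus converges to the
  entropy without any estimate of \<open>|T|\<close> by entropies of types.

  For the divergence it suffices to bound likelihood ratios. Within a type the output is uniform up
  to the factor \<open>1 + b / a\<close> caused by reducing the first seed modulo \<open>b\<close>, on a fraction
  \<open>b |T| / c\<close> of the available strings. Hence no output of a given length has more than
  \<open>flatness n\<close> times its uniform probability; this survives mixing over the types of equal output
  length, and \<open>flatness n\<close>, which does not depend on the source, tends to \<open>1\<close>.
\<close>

subsection \<open>Blocks of independent symbols\<close>

lemma finite_set_replicate_pmf: "finite (set_pmf (replicate_pmf n (p :: 'a::finite pmf)))"
proof -
  have "set_pmf (replicate_pmf n p) \<subseteq> {xs. set xs \<subseteq> UNIV \<and> length xs = n}"
    by (auto simp: set_replicate_pmf)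
  then show ?thesis
    by (rule finite_subset) (rule finite_lists_length_eq, simp)
qed

lemma pmf_replicate_pmf:
  "length xs = n \<Longrightarrow> pmf (replicate_pmf n p) xs = (\<Prod>x\<leftarrow>xs. pmf p x)"
proof (induction n arbitrary: xs)
  case (Suc n)
  then obtain x ys where xs: "xs = x # ys" "length ys = n"
    by (cases xs) auto
  have "replicate_pmf (Suc n) p = map_pmf (\<lambda>(x, xs). x # xs) (pair_pmf p (replicate_pmf n p))"
    by (simp add: map_pmf_def pair_pmf_def bind_assoc_pmf bind_return_pmf)
  moreover have "inj (\<lambda>(x, xs). x # xs)"
    by (auto simp: inj_on_def)
  ultimately have "pmf (replicate_pmf (Suc n) p) xs = pmf (pair_pmf p (replicate_pmf n p)) (x, ys)"
    using pmf_map_inj'[of "\<lambda>(x, xs). x # xs" "pair_pmf p (replicate_pmf n p)" "(x, ys)"]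
    by (simp add: xs)
  then show ?case
    using Suc.IH[OF xs(2)] by (simp add: pmf_pair xs)
qed (simp add: pmf_return)

text \<open>On the support every factor is positive, so the logarithm splits over the product and
  the value of \<open>log\<close> at 0 never enters.\<close>

lemma log_pmf_replicate_pmf:
  assumes "x \<in> set_pmf (replicate_pmf n p)"
  shows "- log 2 (pmf (replicate_pmf n p) x) = (\<Sum>a\<leftarrow>x. - log 2 (pmf p a))"
proof -
  have "set y \<subseteq> set_pmf p \<Longrightarrow> (\<Prod>a\<leftarrow>y. pmf p a) > 0 \<and>
      - log 2 (\<Prod>a\<leftarrow>y. pmf p a) = (\<Sum>a\<leftarrow>y. - log 2 (pmf p a))" for y
  proof (induction y)
    case (Cons a y)
    then show ?case
      using pmf_positive[of a p] by (simp add: log_mult)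
  qed simp
  moreover have "set x \<subseteq> set_pmf p" "length x = n"
    using assms by (auto simp: set_replicate_pmf)
  ultimately show ?thesis
    by (simp add: pmf_replicate_pmf)
qed

text \<open>Conditioning on the first symbol; this recursion drives the induction for the moments of
  the sum.\<close>

lemma expectation_replicate_pmf_Suc:
  fixes p :: "'a::finite pmf" and h :: "'a list \<Rightarrow> real"
  shows "measure_pmf.expectation (replicate_pmf (Suc n) p) h =
    (\<Sum>x\<in>UNIV. pmf p x * measure_pmf.expectation (replicate_pmf n p) (\<lambda>xs. h (x # xs)))"
proof -
  have "replicate_pmf (Suc n) p = p \<bind> (\<lambda>x. map_pmf ((#) x) (replicate_pmf n p))"
    by (simp add: map_pmf_def)
  also have "measure_pmf.expectation \<dots> h = (\<Sum>x\<in>UNIV. pmf p x *\<^sub>R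
      measure_pmf.expectation (map_pmf ((#) x) (replicate_pmf n p)) h)"
    by (rule pmf_expectation_bind) (simp_all add: finite_set_replicate_pmf)
  finally show ?thesis
    by simp
qed

text \<open>Both moments share one induction: when the square is expanded, the cross term is
  \<open>2 * g x\<close> times the mean of the shorter sum, which is 0 by the first half.\<close>

lemma iid_sum_moments:
  fixes p :: "'a::finite pmf" and g :: "'a \<Rightarrow> real"
  assumes g: "measure_pmf.expectation p g = 0"
  shows "measure_pmf.expectation (replicate_pmf n p) (\<lambda>xs. \<Sum>x\<leftarrow>xs. g x) = 0 \<and>
    measure_pmf.expectation (replicate_pmf n p) (\<lambda>xs. (\<Sum>x\<leftarrow>xs. g x)\<^sup>2) =
      real n * measure_pmf.expectation p (\<lambda>x. (g x)\<^sup>2)"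
proof (induction n)
  case (Suc n)
  let ?R = "replicate_pmf n p" and ?S = "\<lambda>xs. \<Sum>x\<leftarrow>xs. g x"
  have int: "integrable (measure_pmf ?R) h" for h :: "'a list \<Rightarrow> real"
    by (rule integrable_measure_pmf_finite[OF finite_set_replicate_pmf])
  have E: "measure_pmf.expectation p h = (\<Sum>x\<in>UNIV. pmf p x * h x)" for h :: "'a \<Rightarrow> real"
    by (simp add: integral_measure_pmf[of UNIV])
  have one: "(\<Sum>x\<in>UNIV. pmf p x) = 1"
    by (simp add: sum_pmf_eq_1)
  have "measure_pmf.expectation ?R (\<lambda>xs. (g x + ?S xs)\<^sup>2) =
      (g x)\<^sup>2 + real n * measure_pmf.expectation p (\<lambda>x. (g x)\<^sup>2)" for x
    using Suc.IH int by (simp add: power2_sum mult.assoc)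
  moreover have "measure_pmf.expectation ?R (\<lambda>xs. g x + ?S xs) = g x" for x
    using Suc.IH int by simp
  ultimately show ?case
    using g one unfolding expectation_replicate_pmf_Suc E
    by (simp add: distrib_left sum.distrib sum_distrib_right[symmetric])
       (simp add: distrib_right)
qed simp

text \<open>Chebyshev's inequality for the centred sum: its variance is \<open>n * V\<close>, so a
  deviation of \<open>n * \<epsilon>\<close> has probability at most
  \<open>V / (n * \<epsilon>\<^sup>2)\<close>.\<close>

lemma weak_law_replicate_pmf:
  fixes p :: "'a::finite pmf" and f :: "'a \<Rightarrow> real"
  shows "p_lim (\<lambda>n. replicate_pmf n p) (\<lambda>n xs. (\<Sum>x\<leftarrow>xs. f x) / real n)
    (measure_pmf.expectation p f)"
  unfolding p_lim_def
proof (intro allI impI)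
  fix \<epsilon> :: real assume \<epsilon>: "\<epsilon> > 0"
  define \<mu> where "\<mu> = measure_pmf.expectation p f"
  define g where "g x = f x - \<mu>" for x
  define V where "V = measure_pmf.expectation p (\<lambda>x. (g x)\<^sup>2)"
  let ?R = "\<lambda>n. replicate_pmf n p" and ?S = "\<lambda>xs. \<Sum>x\<leftarrow>xs. g x"
  have g0: "measure_pmf.expectation p g = 0"
    unfolding g_def
    by (subst Bochner_Integration.integral_diff) (simp_all add: \<mu>_def integrable_measure_pmf_finite)
  have sum_g: "?S xs = (\<Sum>x\<leftarrow>xs. f x) - real (length xs) * \<mu>" for xs
    by (induction xs) (auto simp: g_def algebra_simps)
  have bound: "measure_pmf.prob (?R n) {xs. \<bar>(\<Sum>x\<leftarrow>xs. f x) / real n - \<mu>\<bar> > \<epsilon>} \<le> V / (real n * \<epsilon>\<^sup>2)"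
    if n: "n \<ge> 1" for n
  proof -
    have ES: "measure_pmf.expectation (?R n) ?S = 0" "measure_pmf.variance (?R n) ?S = real n * V"
      unfolding V_def using iid_sum_moments[OF g0, of n] by simp_all
    \<comment> \<open>Centring subtracts \<open>length xs * \<mu>\<close>, which is
      \<open>n * \<mu>\<close> on the support; hence an inclusion almost everywhere.\<close>
    have "measure_pmf.prob (?R n) {xs. \<bar>(\<Sum>x\<leftarrow>xs. f x) / real n - \<mu>\<bar> > \<epsilon>} \<le>
        measure_pmf.prob (?R n) {xs. \<bar>?S xs\<bar> \<ge> real n * \<epsilon>}"
    proof (rule measure_pmf.finite_measure_mono_AE)
      have "\<bar>?S xs\<bar> \<ge> real n * \<epsilon>"
        if "length xs = n" "\<bar>(\<Sum>x\<leftarrow>xs. f x) / real n - \<mu>\<bar> > \<epsilon>" for xs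
      proof -
        have "?S xs = real n * ((\<Sum>x\<leftarrow>xs. f x) / real n - \<mu>)"
          using that n by (simp add: sum_g algebra_simps)
        then show ?thesis
          using that n by (simp add: abs_mult)
      qed
      then show "AE xs \<in> {xs. \<bar>(\<Sum>x\<leftarrow>xs. f x) / real n - \<mu>\<bar> > \<epsilon>} in measure_pmf (?R n).
          xs \<in> {xs. \<bar>?S xs\<bar> \<ge> real n * \<epsilon>}"
        by (auto simp: AE_measure_pmf_iff set_replicate_pmf)
    qed simp
    also have "\<dots> \<le> real n * V / (real n * \<epsilon>)\<^sup>2"
      using measure_pmf.Chebyshev_inequality[of ?S "?R n" "real n * \<epsilon>"] n \<epsilon> ES
      by (simp add: integrable_measure_pmf_finite[OF finite_set_replicate_pmf])
    also have "\<dots> = V / (real n * \<epsilon>\<^sup>2)"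
      using n \<epsilon> by (simp add: power2_eq_square)
    finally show ?thesis .
  qed
  show "(\<lambda>n. measure_pmf.prob (?R n) {xs. \<bar>(\<Sum>x\<leftarrow>xs. f x) / real n - measure_pmf.expectation p f\<bar> > \<epsilon>})
      \<longlonglongrightarrow> 0"
  proof (rule tendsto_sandwich[OF _ _ tendsto_const])
    show "(\<lambda>n. V / (real n * \<epsilon>\<^sup>2)) \<longlonglongrightarrow> 0"
      using lim_const_over_n[of "V / \<epsilon>\<^sup>2"] by (simp add: mult.commute)
  qed (use bound in \<open>auto simp: \<mu>_def intro!: eventually_sequentiallyI[of 1]\<close>)
qed

subsection \<open>Entropy and divergence of finite distributions\<close>

text \<open>The library's entropy is minus the divergence from the counting measure, relative to
  which the density of \<open>p\<close> is its mass function.\<close>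

lemma source_entropy_eq_expectation:
  fixes p :: "'a::finite pmf"
  shows "source_entropy p = measure_pmf.expectation p (\<lambda>x. - log 2 (pmf p x))"
proof -
  interpret C: sigma_finite_measure "count_space (UNIV :: 'a set)"
    by (rule sigma_finite_measure_count_space)
  have "source_entropy p = - KL_divergence 2 (count_space UNIV) (density (count_space UNIV) (pmf p))"
    unfolding source_entropy_def prob_space.entropy_def[OF measure_pmf.prob_space_axioms]
    by (simp add: distr_id2 flip: measure_pmf_eq_density)
  also have "\<dots> = - (\<Sum>x\<in>UNIV. pmf p x * log 2 (pmf p x))"
    by (subst C.KL_density) (auto simp: lebesgue_integral_count_space_finite)
  also have "\<dots> = measure_pmf.expectation p (\<lambda>x. - log 2 (pmf p x))"
    by (simp add: integral_measure_pmf[of UNIV] sum_negf)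
  finally show ?thesis .
qed

text \<open>The density \<open>D\<close> of \<open>Q\<close> with respect to the uniform law is at
  most \<open>K\<close> and has mean 1, so the mean of \<open>D * log 2 D\<close> is at most
  \<open>log 2 K\<close>. The lower bound is Gibbs' inequality.\<close>

lemma KL_divergence_pmf_of_set_bounds:
  assumes A: "finite A" "set_pmf Q \<subseteq> A"
    and K: "\<And>w. w \<in> A \<Longrightarrow> pmf Q w \<le> K / real (card A)"
  shows "0 \<le> KL_divergence 2 (measure_pmf (pmf_of_set A)) (measure_pmf Q)"
    and "KL_divergence 2 (measure_pmf (pmf_of_set A)) (measure_pmf Q) \<le> log 2 K"
proof -
  let ?M = "pmf_of_set A"
  define D where "D w = real (card A) * pmf Q w" for w
  interpret M: information_space "measure_pmf ?M" 2
    by unfold_locales simp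
  have ne: "A \<noteq> {}"
    using A set_pmf_not_empty[of Q] by auto
  then have card: "real (card A) > 0"
    using A by (simp add: card_gt_0_iff)
  \<comment> \<open>Outside \<open>A\<close> both sides vanish because the support of
    \<open>Q\<close> lies in \<open>A\<close>; this is where absolute continuity comes from.\<close>
  have "ennreal (pmf ?M w) * ennreal (D w) = ennreal (pmf Q w)" for w
  proof (cases "w \<in> A")
    case True
    then show ?thesis
      using A ne card by (simp add: D_def flip: ennreal_mult)
  next
    case False
    then have "pmf Q w = 0"
      using A by (auto simp: pmf_eq_0_set_pmf)
    then show ?thesis
      by (simp add: D_def)
  qed
  then have dens: "measure_pmf Q = density (measure_pmf ?M) D"
    by (simp add: measure_pmf_eq_density density_density_eq)
  have D_nonneg: "D w \<ge> 0" for w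
    by (simp add: D_def)
  have int: "integrable (measure_pmf ?M) (\<lambda>w. D w * log 2 (D w))"
    using A ne by (intro integrable_measure_pmf_finite) simp
  show "0 \<le> KL_divergence 2 (measure_pmf ?M) (measure_pmf Q)"
    unfolding dens
    by (rule M.KL_nonneg)
       (use int D_nonneg measure_pmf.prob_space_axioms[of Q] in \<open>auto simp flip: dens\<close>)
  have "KL_divergence 2 (measure_pmf ?M) (measure_pmf Q) = (\<Sum>w\<in>A. D w * log 2 (D w)) / card A"
    unfolding dens using A ne D_nonneg by (subst sigma_finite_measure.KL_density[OF measure_pmf.sigma_finite_measure_axioms]) (auto simp: integral_pmf_of_set)
  also have "\<dots> \<le> (\<Sum>w\<in>A. D w * log 2 K) / card A"
  proof (intro divide_right_mono sum_mono)
    fix w assume w: "w \<in> A"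
    show "D w * log 2 (D w) \<le> D w * log 2 K"
    proof (cases "D w = 0")
      case False
      then have "D w > 0"
        using D_nonneg[of w] by linarith
      moreover have "D w \<le> K"
        using K[OF w] card by (simp add: D_def field_simps)
      ultimately show ?thesis
        by (intro mult_left_mono log_mono) auto
    qed simp
  qed simp
  also have "\<dots> = log 2 K"
    using sum_pmf_eq_1[OF A] card
    by (simp add: D_def sum_distrib_right[symmetric] sum_distrib_left[symmetric])
  finally show "KL_divergence 2 (measure_pmf ?M) (measure_pmf Q) \<le> log 2 K" .
qed

section \<open>Elementary counting, rounding and bit bounds\<close>

lemma card_mod_eq_le:
  fixes a b j :: nat
  assumes b: "b > 0"
  shows "card {u. u < a \<and> u mod b = j} \<le> a div b + 1"
proof -
  \<comment> \<open>Within a residue class an element is determined by its quotient. The extra 1 in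
    the count stands for the incomplete last period.\<close>
  have "inj_on (\<lambda>u. u div b) {u. u < a \<and> u mod b = j}"
    by (rule inj_onI) (metis (mono_tags, lifting) div_mult_mod_eq mem_Collect_eq)
  moreover have "(\<lambda>u. u div b) ` {u. u < a \<and> u mod b = j} \<subseteq> {..a div b}"
    by (auto intro: div_le_mono)
  ultimately have "card {u. u < a \<and> u mod b = j} \<le> card {..a div b}"
    by (rule card_inj_on_le) simp
  then show ?thesis
    by simp
qed

text \<open>Rounding the exponent up costs at most a factor 2; nonnegativity keeps
  \<open>nat\<close> from truncating.\<close>

lemma two_power_nat_ceiling_bounds:
  fixes x :: real
  assumes "x \<ge> 0"
  shows "2 powr x \<le> 2 ^ nat \<lceil>x\<rceil>" and "2 ^ nat \<lceil>x\<rceil> \<le> 2 * 2 powr x"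
proof -
  have "x \<le> real (nat \<lceil>x\<rceil>)" "real (nat \<lceil>x\<rceil>) \<le> x + 1"
    using assms by linarith+
  then have "2 powr x \<le> 2 powr real (nat \<lceil>x\<rceil>)" "2 powr real (nat \<lceil>x\<rceil>) \<le> 2 powr (x + 1)"
    by (auto intro: powr_mono)
  then show "2 powr x \<le> 2 ^ nat \<lceil>x\<rceil>" and "2 ^ nat \<lceil>x\<rceil> \<le> 2 * 2 powr x"
    by (simp_all add: powr_realpow powr_add)
qed

lemma xor_less_two_power:
  fixes a b :: nat
  assumes "a < 2 ^ m" "b < 2 ^ m"
  shows "xor a b < 2 ^ m"
proof -
  have "take_bit m (xor a b) = xor a b"
    using assms by (simp add: take_bit_nat_eq_self)
  then show ?thesis
    by (metis take_bit_nat_less_exp)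
qed

subsection \<open>Type classes\<close>

text \<open>Frequencies times the common length give back the counts. The case \<open>n = 0\<close>
  is separate because the masses of \<open>pmf_of_multiset\<close> are frequencies for nonempty
  multisets only.\<close>

lemma type_of_block_eq_imp_mset_eq:
  assumes "length x = n" "length y = n" "type_of_block x = type_of_block y"
  shows "mset x = mset y"
proof (cases "n = 0")
  case False
  then have "x \<noteq> []" "y \<noteq> []"
    using assms by auto
  then have "real (count (mset x) a) / real n = real (count (mset y) a) / real n" for a
    using arg_cong[OF assms(3), of "\<lambda>P. pmf P a"] assms(1,2)
    by (simp add: type_of_block_def)
  with False show ?thesis
    by (auto intro: multiset_eqI)
qed (use assms in simp)

text \<open>The probability of a block is a product over its multiset of symbols, so the order does
  not matter.\<close>

lemma pmf_replicate_pmf_eq_if_type_eq: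
  assumes "x \<in> blocks n" "y \<in> blocks n" "type_of_block x = type_of_block y"
  shows "pmf (replicate_pmf n p) x = pmf (replicate_pmf n p) y"
proof -
  have "mset x = mset y" "length x = n" "length y = n"
    using assms by (auto simp: blocks_def intro: type_of_block_eq_imp_mset_eq)
  then show ?thesis
    by (simp add: pmf_replicate_pmf flip: prod_mset_prod_list mset_map)
       (metis mset_map prod_mset_prod_list)
qed

lemma finite_blocks: "finite (blocks n :: 'a::finite list set)"
  using finite_lists_length_eq[of "UNIV :: 'a set" n] by (simp add: blocks_def)

lemma set_replicate_pmf_subset_blocks: "set_pmf (replicate_pmf n p) \<subseteq> blocks n"
  by (auto simp: set_replicate_pmf blocks_def)

lemma finite_types: "finite (types n :: 'a::finite pmf set)"
  by (simp add: types_def finite_blocks)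

lemma finite_type_cls: "finite (type_cls n (P :: 'a::finite pmf))"
  by (simp add: type_cls_def finite_blocks)

lemma card_type_cls_pos: "P \<in> types n \<Longrightarrow> card (type_cls n (P :: 'a::finite pmf)) > 0"
  unfolding card_gt_0_iff using finite_type_cls by (auto simp: types_def type_cls_def)

lemma type_of_block_in_types: "x \<in> blocks n \<Longrightarrow> type_of_block x \<in> types n"
  by (simp add: types_def)

text \<open>The source is uniform on each type class. This identity trades the size of a class for
  probabilities, both for the rate and for the uniformity of the output.\<close>

lemma prob_type_cls:
  fixes p :: "'a::finite pmf"
  assumes "x \<in> blocks n"
  shows "measure_pmf.prob (replicate_pmf n p) (type_cls n (type_of_block x)) =
    real (card (type_cls n (type_of_block x))) * pmf (replicate_pmf n p) x"
proof -
  have "measure_pmf.prob (replicate_pmf n p) (type_cls n (type_of_block x)) =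
      (\<Sum>y\<in>type_cls n (type_of_block x). pmf (replicate_pmf n p) x)"
    unfolding measure_measure_pmf_finite[OF finite_type_cls]
    by (rule sum.cong) (auto simp: type_cls_def intro!: pmf_replicate_pmf_eq_if_type_eq assms)
  then show ?thesis
    by simp
qed

text \<open>Union bound over the rare types, whose number is at most that of all types.\<close>

lemma prob_rare_type_le:
  fixes p :: "'a::finite pmf"
  assumes "\<delta> \<ge> 0"
  shows "measure_pmf.prob (replicate_pmf n p)
      {x \<in> blocks n. measure_pmf.prob (replicate_pmf n p) (type_cls n (type_of_block x)) < \<delta>}
    \<le> real (card (types n :: 'a pmf set)) * \<delta>"
proof -
  let ?R = "replicate_pmf n p"
  let ?B = "{P \<in> types n. measure_pmf.prob ?R (type_cls n P) < \<delta>}"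
  have "{x \<in> blocks n. measure_pmf.prob ?R (type_cls n (type_of_block x)) < \<delta>} =
      (\<Union>P\<in>?B. type_cls n P)"
    by (auto simp: types_def type_cls_def)
  then have "measure_pmf.prob ?R {x \<in> blocks n. measure_pmf.prob ?R (type_cls n (type_of_block x)) < \<delta>}
      \<le> (\<Sum>P\<in>?B. measure_pmf.prob ?R (type_cls n P))"
    by (simp add: measure_pmf.finite_measure_subadditive_finite finite_types)
  also have "\<dots> \<le> (\<Sum>P\<in>?B. \<delta>)"
    by (rule sum_mono) simp
  also have "\<dots> \<le> real (card (types n :: 'a pmf set)) * \<delta>"
    using assms by (simp add: mult_right_mono card_mono finite_types)
  finally show ?thesis .
qed

subsection \<open>The coding scheme\<close>

lemma gamma_len_bounds:
  "real q * log 2 (real (n + 1)) \<le> real (gamma_len q n)"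
  "real (gamma_len q n) \<le> real q * log 2 (real (n + 1)) + 1"
proof -
  have "real q * log 2 (real (n + 1)) \<ge> 0"
    by simp
  then show "real q * log 2 (real (n + 1)) \<le> real (gamma_len q n)"
    and "real (gamma_len q n) \<le> real q * log 2 (real (n + 1)) + 1"
    unfolding gamma_len_def by linarith+
qed

text \<open>The two ceilings add at most 2 in total, and \<open>log 2 (n + 1) / log 2 n\<close>
  tends to 1. Convergence yields both halves of the order claim at once.\<close>

lemma seed_len_over_log_tendsto:
  assumes "\<alpha> \<ge> 0"
  shows "(\<lambda>n. real (seed_len \<alpha> q n) / log 2 (real n)) \<longlonglongrightarrow> real q + \<alpha>"
proof (rule tendsto_sandwich)
  let ?l = "\<lambda>n::nat. log 2 (real (n + 1)) / log 2 (real n)"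
  have l: "?l \<longlonglongrightarrow> 1"
    by real_asymp
  have inv: "(\<lambda>n::nat. 2 / log 2 (real n)) \<longlonglongrightarrow> 0"
    by real_asymp
  show "(\<lambda>n. real q * ?l n + \<alpha>) \<longlonglongrightarrow> real q + \<alpha>"
    using tendsto_add[OF tendsto_mult[OF tendsto_const l] tendsto_const, of "real q" \<alpha>] by simp
  show "(\<lambda>n. real q * ?l n + \<alpha> + 2 / log 2 (real n)) \<longlonglongrightarrow> real q + \<alpha>"
    using tendsto_add[OF tendsto_add[OF tendsto_mult[OF tendsto_const l] tendsto_const] inv, of "real q" \<alpha>]
    by simp
  have bounds: "real q * ?l n + \<alpha> \<le> real (seed_len \<alpha> q n) / log 2 (real n) \<and>
      real (seed_len \<alpha> q n) / log 2 (real n) \<le> real q * ?l n + \<alpha> + 2 / log 2 (real n)"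
    if n: "n \<ge> 2" for n
  proof -
    have pos: "log 2 (real n) > 0"
      using n by simp
    then have "\<alpha> * log 2 (real n) \<ge> 0"
      using assms by simp
    then have "\<alpha> * log 2 (real n) \<le> real (nat \<lceil>\<alpha> * log 2 (real n)\<rceil>)"
      "real (nat \<lceil>\<alpha> * log 2 (real n)\<rceil>) \<le> \<alpha> * log 2 (real n) + 1"
      by linarith+
    with gamma_len_bounds[of q n]
    have "real q * log 2 (real (n + 1)) + \<alpha> * log 2 (real n) \<le> real (seed_len \<alpha> q n)"
      "real (seed_len \<alpha> q n) \<le> real q * log 2 (real (n + 1)) + \<alpha> * log 2 (real n) + 2"
      unfolding seed_len_def by simp_all
    with pos show ?thesis
      by (simp add: le_divide_eq divide_le_eq distrib_right)
  qed
  show "\<forall>\<^sub>F n in sequentially. real q * ?l n + \<alpha> \<le> real (seed_len \<alpha> q n) / log 2 (real n)"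
    "\<forall>\<^sub>F n in sequentially. real (seed_len \<alpha> q n) / log 2 (real n) \<le>
      real q * ?l n + \<alpha> + 2 / log 2 (real n)"
    using bounds by (auto intro!: eventually_sequentiallyI[of 2])
qed

lemma two_powr_mult_log: "x > 0 \<Longrightarrow> 2 powr (a * log 2 x) = x powr a"
  by (simp add: powr_def log_def)

lemma a_size_ge:
  assumes "\<alpha> \<ge> 0" "n \<ge> 1"
  shows "real (a_size \<alpha> n) \<ge> real n powr \<alpha>"
proof -
  have "2 powr (\<alpha> * log 2 (real n)) \<le> real (a_size \<alpha> n)"
    using two_power_nat_ceiling_bounds(1)[of "\<alpha> * log 2 (real n)"] assms by (simp add: a_size_def)
  also have "2 powr (\<alpha> * log 2 (real n)) = real n powr \<alpha>"
    using assms by (simp add: two_powr_mult_log)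
  finally show ?thesis .
qed

text \<open>The parameters are the free choices of the scheme. The source distribution is not among
  them: it enters single lemmas as a variable, in keeping with universality.\<close>

locale type_scheme =
  fixes \<alpha> \<beta> :: real
    and s :: "nat \<Rightarrow> 'a::finite pmf \<Rightarrow> nat"
    and k :: "nat \<Rightarrow> nat \<Rightarrow> 'a list \<Rightarrow> nat"
  assumes \<alpha>_gt: "\<alpha> > \<beta>" and \<beta>_gt: "\<beta> > 1"
    and inj_s: "n \<ge> 1 \<Longrightarrow> inj_on (s n) (types n)"
    and s_less: "n \<ge> 1 \<Longrightarrow> s n ` types n \<subseteq> {..<2 ^ gamma_len CARD('a) n}"
    and bij_k: "n \<ge> 1 \<Longrightarrow> P \<in> types n \<Longrightarrow>
           bij_betw (k n (s n P)) (type_cls n P) {..<card (type_cls n P)}"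
begin

text \<open>The index map \<open>s n\<close> embeds the types into a set of polynomial size.\<close>

lemma card_types_le:
  assumes "n \<ge> 1"
  shows "card (types n :: 'a pmf set) \<le> 2 ^ gamma_len CARD('a) n"
  using card_inj_on_le[OF inj_s[OF assms] s_less[OF assms]] by simp

lemma c_exponent_nonneg:
  fixes P :: "'a pmf"
  assumes "n \<ge> 1" "P \<in> types n"
  shows "log 2 (real (card (type_cls n P))) + \<beta> * log 2 (real n) \<ge> 0"
proof -
  have "real (card (type_cls n P)) \<ge> 1"
    using card_type_cls_pos[OF assms(2)] by linarith
  then show ?thesis
    using assms \<beta>_gt by (intro add_nonneg_nonneg mult_nonneg_nonneg) auto
qed

lemma c_size_bounds:
  fixes P :: "'a pmf"
  assumes n: "n \<ge> 1" and P: "P \<in> types n"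
  shows "real (card (type_cls n P)) * real n powr \<beta> \<le> real (c_size \<beta> n P)"
    and "real (c_size \<beta> n P) \<le> 2 * (real (card (type_cls n P)) * real n powr \<beta>)"
proof -
  have "2 powr (log 2 (real (card (type_cls n P))) + \<beta> * log 2 (real n)) =
      real (card (type_cls n P)) * real n powr \<beta>"
    using n card_type_cls_pos[OF P] by (simp add: powr_add two_powr_mult_log)
  then show "real (card (type_cls n P)) * real n powr \<beta> \<le> real (c_size \<beta> n P)"
    and "real (c_size \<beta> n P) \<le> 2 * (real (card (type_cls n P)) * real n powr \<beta>)"
    using two_power_nat_ceiling_bounds[OF c_exponent_nonneg[OF n P]] by (simp_all add: c_size_def)
qed

lemma b_size_eq: "b_size \<beta> n P = c_size \<beta> n P div card (type_cls n P)"
  by (simp add: b_size_def floor_divide_of_nat_eq)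

lemma card_type_cls_le_c_size:
  fixes P :: "'a pmf"
  assumes n: "n \<ge> 1" and P: "P \<in> types n"
  shows "card (type_cls n P) \<le> c_size \<beta> n P"
proof -
  have "real n powr \<beta> \<ge> 1"
    using n \<beta>_gt by (intro ge_one_powr_ge_zero) auto
  then have "real (card (type_cls n P)) * 1 \<le> real (card (type_cls n P)) * real n powr \<beta>"
    by (intro mult_left_mono) auto
  with c_size_bounds(1)[OF assms] show ?thesis
    by linarith
qed

text \<open>If \<open>b_size\<close> were 0, reduction modulo it would leave the seed unreduced; a
  class that fits into \<open>c_size\<close> excludes this.\<close>

lemma b_size_pos:
  fixes P :: "'a pmf"
  assumes "n \<ge> 1" "P \<in> types n"
  shows "b_size \<beta> n P > 0"
  using card_type_cls_le_c_size[OF assms] card_type_cls_pos[OF assms(2)]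
  by (simp add: b_size_eq div_greater_zero_iff)

lemma k_less:
  assumes "n \<ge> 1" "x \<in> blocks n"
  shows "k n (s n (type_of_block x)) x < card (type_cls n (type_of_block x))"
  using bij_betwE[OF bij_k[OF assms(1) type_of_block_in_types[OF assms(2)]]] assms
  by (auto simp: type_cls_def)

text \<open>The range below \<open>c\<close> contains \<open>b\<close> disjoint intervals of length
  \<open>|T|\<close>, and the first component is position \<open>k\<close> in interval number
  \<open>v\<close>.\<close>

lemma encode_in_outputs:
  assumes n: "n \<ge> 1" and x: "x \<in> blocks n" and u: "u \<in> seeds \<alpha> CARD('a) n"
  shows "encode \<beta> s k n x u \<in> outputs \<beta> n x"
proof -
  let ?P = "type_of_block x"
  let ?t = "card (type_cls n ?P)" and ?b = "b_size \<beta> n ?P"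
  have P: "?P \<in> types n"
    by (rule type_of_block_in_types[OF x])
  have "v_idx \<beta> n ?P (fst u) + 1 \<le> ?b"
    using b_size_pos[OF n P] by (simp add: v_idx_def Suc_leI)
  then have "(v_idx \<beta> n ?P (fst u) + 1) * ?t \<le> ?b * ?t"
    by (rule mult_right_mono) simp
  also have "\<dots> \<le> c_size \<beta> n ?P"
    by (simp add: b_size_eq div_times_less_eq_dividend)
  finally have "k n (s n ?P) x + v_idx \<beta> n ?P (fst u) * ?t < c_size \<beta> n ?P"
    using k_less[OF n x] by simp
  moreover have "xor (s n ?P) (snd u) < 2 ^ gamma_len CARD('a) n"
    using s_less[OF n] P u by (intro xor_less_two_power) (auto simp: seeds_def)
  ultimately show ?thesis
    by (simp add: encode_def outputs_def Let_def)
qed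

text \<open>A second \<open>xor\<close> with the same key restores the type index; type and seed
  then determine the shift, and what remains is the index within the class. No randomness of the
  seed is involved.\<close>

lemma decode_encode:
  assumes n: "n \<ge> 1" and x: "x \<in> blocks n"
  shows "decode \<beta> s k n (encode \<beta> s k n x u) u = x"
proof -
  let ?P = "type_of_block x"
  have P: "?P \<in> types n"
    by (rule type_of_block_in_types[OF x])
  have "xor (snd u) (xor (s n ?P) (snd u)) = s n ?P"
    by (simp add: xor.assoc[symmetric] xor.commute[of "snd u"] ) (simp add: xor.assoc)
  moreover have "inv_into (types n) (s n) (s n ?P) = ?P"
    using inj_s[OF n] P by simp
  moreover have "inv_into (type_cls n ?P) (k n (s n ?P)) (k n (s n ?P) x) = x"
    using bij_k[OF n P] x by (intro inv_into_f_f) (auto simp: bij_betw_def type_cls_def)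
  ultimately show ?thesis
    by (simp add: decode_def encode_def Let_def)
qed

lemma out_len_eq:
  "out_len \<beta> n (x :: 'a list) =
    real (nat \<lceil>log 2 (real (card (type_cls n (type_of_block x)))) + \<beta> * log 2 (real n)\<rceil> + gamma_len CARD('a) n)"
  by (simp add: out_len_def c_size_def log_nat_power flip: power_add)

text \<open>The \<open>gamma_len\<close> part is common to all blocks. Conditioning on the output
  length thus means conditioning on the value of \<open>c_size\<close>.\<close>

lemma out_len_eq_iff_c_size_eq:
  "out_len \<beta> n (x :: 'a list) = out_len \<beta> n (y :: 'a list) \<longleftrightarrow>
    c_size \<beta> n (type_of_block x) = c_size \<beta> n (type_of_block y)"
  by (simp add: out_len_eq c_size_def)

lemma finite_seeds: "finite (seeds \<alpha> CARD('a) n)"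
  by (simp add: seeds_def)

lemma seeds_nonempty: "seeds \<alpha> CARD('a) n \<noteq> {}"
  by (simp add: seeds_def a_size_def lessThan_empty_iff)

lemma uniform_source_code:
  assumes n: "n \<ge> 1"
  shows "uniform_source_code n (seed_len \<alpha> CARD('a) n) (seeds \<alpha> CARD('a) n)
    (out_len \<beta> n) (outputs \<beta> n) (encode \<beta> s k n) (decode \<beta> s k n)"
proof -
  have "card (seeds \<alpha> CARD('a) n) = 2 ^ seed_len \<alpha> CARD('a) n"
    by (simp add: seeds_def a_size_def seed_len_def power_add)
  moreover have "\<exists>l::nat. out_len \<beta> n x = real l \<and> finite (outputs \<beta> n x) \<and> card (outputs \<beta> n x) = 2 ^ l"
    for x :: "'a list"
    by (rule exI, rule conjI[OF out_len_eq]) (simp add: outputs_def c_size_def power_add)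
  moreover have "outputs \<beta> n x = outputs \<beta> n y" if "out_len \<beta> n x = out_len \<beta> n y" for x y :: "'a list"
    using that by (simp add: out_len_eq_iff_c_size_eq outputs_def)
  moreover have "encode \<beta> s k n x u \<in> outputs \<beta> n x \<and>
      decode \<beta> s k n (encode \<beta> s k n x u) u \<in> blocks n"
    if "x \<in> blocks n" "u \<in> seeds \<alpha> CARD('a) n" for x u
    using that by (simp add: encode_in_outputs[OF n] decode_encode[OF n])
  ultimately show ?thesis
    unfolding uniform_source_code_def using finite_seeds by blast
qed

lemma decoding_error_prob:
  assumes n: "n \<ge> 1"
  shows "measure_pmf.prob (source_seed_pmf \<alpha> n p)
    {(x, u). x \<noteq> decode \<beta> s k n (encode \<beta> s k n x u) u} = 0"
proof -
  have "x = decode \<beta> s k n (encode \<beta> s k n x u) u" if "x \<in> set_pmf (replicate_pmf n p)" for x u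
    using that set_replicate_pmf_subset_blocks decode_encode[OF n] by (metis subsetD)
  then show ?thesis
    by (auto simp: measure_pmf_zero_iff source_seed_pmf_def)
qed

subsection \<open>Rate\<close>

text \<open>By \<open>prob_type_cls\<close>, \<open>log |T|\<close> is the self-information of
  \<open>x\<close> plus the logarithm of the class probability, which lies between
  \<open>- log 2 n - gamma_len\<close> and 0 for a class that is not rare. Everything else in the
  length is \<open>\<beta> * log 2 n\<close>, a ceiling and \<open>gamma_len\<close>; one coarse
  bound covers both signs.\<close>

lemma out_len_near_self_information:
  fixes p :: "'a pmf"
  assumes n: "n \<ge> 1" and x: "x \<in> set_pmf (replicate_pmf n p)"
    and typical: "measure_pmf.prob (replicate_pmf n p) (type_cls n (type_of_block x)) \<ge>
      1 / (real n * 2 ^ gamma_len CARD('a) n)"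
  shows "\<bar>out_len \<beta> n x - (\<Sum>a\<leftarrow>x. - log 2 (pmf p a))\<bar> \<le>
    (\<beta> + 1) * log 2 (real n) + 2 * real (gamma_len CARD('a) n) + 1"
proof -
  let ?R = "replicate_pmf n p" and ?P = "type_of_block x"
  let ?T = "type_cls n ?P" and ?g = "gamma_len CARD('a) n"
  let ?pr = "measure_pmf.prob ?R ?T" and ?I = "\<Sum>a\<leftarrow>x. - log 2 (pmf p a)"
  have blocks: "x \<in> blocks n"
    using x set_replicate_pmf_subset_blocks by blast
  have P: "?P \<in> types n"
    by (rule type_of_block_in_types[OF blocks])
  have ln_n: "log 2 (real n) \<ge> 0"
    using n by simp
  then have ln_n': "\<beta> * log 2 (real n) \<ge> 0"
    using \<beta>_gt by simp
  have "log 2 ?pr = log 2 (real (card ?T)) + log 2 (pmf ?R x)"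
    using prob_type_cls[OF blocks, of p] card_type_cls_pos[OF P] pmf_positive[OF x]
    by (simp add: log_mult)
  then have card: "log 2 (real (card ?T)) = ?I + log 2 ?pr"
    using log_pmf_replicate_pmf[OF x] by simp
  have pos: "1 / (real n * 2 ^ ?g) > 0"
    using n by simp
  with typical have "log 2 (1 / (real n * 2 ^ ?g)) \<le> log 2 ?pr"
    by (intro log_mono) auto
  moreover have "log 2 (1 / (real n * 2 ^ ?g)) = - log 2 (real n) - real ?g"
    using n by (simp add: log_divide log_mult log_nat_power)
  moreover have "log 2 ?pr \<le> 0"
    using order_less_le_trans[OF pos typical] by simp
  moreover have "real (nat \<lceil>log 2 (real (card ?T)) + \<beta> * log 2 (real n)\<rceil>) \<ge>
      log 2 (real (card ?T)) + \<beta> * log 2 (real n)"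
    "real (nat \<lceil>log 2 (real (card ?T)) + \<beta> * log 2 (real n)\<rceil>) \<le>
      log 2 (real (card ?T)) + \<beta> * log 2 (real n) + 1"
    using c_exponent_nonneg[OF n P] by linarith+
  ultimately show ?thesis
    using card ln_n ln_n' unfolding out_len_eq abs_le_iff by (simp add: distrib_right)
qed

lemma overhead_rate_tendsto:
  "(\<lambda>n. ((\<beta> + 1) * log 2 (real n) + 2 * real (gamma_len CARD('a) n) + 1) / real n) \<longlonglongrightarrow> 0"
proof (rule tendsto_sandwich[OF _ _ tendsto_const])
  \<comment> \<open>The 3 collects the additive 1 and one unit of rounding for each of the two
    copies of \<open>gamma_len\<close>.\<close>
  have "(\<lambda>n::nat. log 2 (real n) / real n) \<longlonglongrightarrow> 0" "(\<lambda>n::nat. log 2 (real (n + 1)) / real n) \<longlonglongrightarrow> 0"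
    "(\<lambda>n::nat. 3 / real n) \<longlonglongrightarrow> 0"
    by real_asymp+
  from tendsto_add[OF tendsto_add[OF tendsto_mult[OF tendsto_const this(1)]
      tendsto_mult[OF tendsto_const this(2)]] this(3), of "\<beta> + 1" "2 * real CARD('a)"]
  show "(\<lambda>n. (\<beta> + 1) * (log 2 (real n) / real n) + 2 * real CARD('a) * (log 2 (real (n + 1)) / real n)
      + 3 / real n) \<longlonglongrightarrow> 0"
    by simp
  have "((\<beta> + 1) * log 2 (real n) + 2 * real (gamma_len CARD('a) n) + 1) / real n \<le>
      (\<beta> + 1) * (log 2 (real n) / real n) + 2 * real CARD('a) * (log 2 (real (n + 1)) / real n)
      + 3 / real n" if "n \<ge> 1" for n
    using that gamma_len_bounds(2)[of "CARD('a)" n]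
    by (simp add: add_divide_distrib[symmetric] divide_right_mono)
  then show "\<forall>\<^sub>F n in sequentially.
      ((\<beta> + 1) * log 2 (real n) + 2 * real (gamma_len CARD('a) n) + 1) / real n \<le>
      (\<beta> + 1) * (log 2 (real n) / real n) + 2 * real CARD('a) * (log 2 (real (n + 1)) / real n)
      + 3 / real n"
    by (auto intro!: eventually_sequentiallyI[of 1])
  show "\<forall>\<^sub>F n in sequentially.
      0 \<le> ((\<beta> + 1) * log 2 (real n) + 2 * real (gamma_len CARD('a) n) + 1) / real n"
    using \<beta>_gt by (auto intro!: eventually_sequentiallyI[of 1] divide_nonneg_nonneg add_nonneg_nonneg)
qed

text \<open>If the overhead rate is below \<open>\<epsilon> / 2\<close>, a deviation by
  \<open>\<epsilon>\<close> forces either a rare type or a deviation of the self-information rate by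
  \<open>\<epsilon> / 2\<close>. The weak law handles the latter, entropy being the mean
  self-information of a symbol.\<close>

lemma out_len_rate_p_lim:
  fixes p :: "'a pmf"
  shows "p_lim (\<lambda>n. replicate_pmf n p) (\<lambda>n x. out_len \<beta> n x / real n) (source_entropy p)"
  unfolding p_lim_def
proof (intro allI impI)
  fix \<epsilon> :: real assume \<epsilon>: "\<epsilon> > 0"
  define r where "r n = (\<beta> + 1) * log 2 (real n) + 2 * real (gamma_len CARD('a) n) + 1" for n
  let ?R = "\<lambda>n. replicate_pmf n p" and ?I = "\<lambda>x. \<Sum>a\<leftarrow>x. - log 2 (pmf p a)"
  let ?H = "source_entropy p"
  \<comment> \<open>Small enough that the union bound over the types leaves \<open>1 / n\<close>,
    large enough that its logarithm is of order \<open>log n\<close>.\<close>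
  define \<delta> where "\<delta> n = 1 / (real n * 2 ^ gamma_len CARD('a) n)" for n
  let ?dev = "\<lambda>n. {x. \<bar>?I x / real n - ?H\<bar> > \<epsilon> / 2}"
  let ?rare = "\<lambda>n. {x \<in> blocks n. measure_pmf.prob (?R n) (type_cls n (type_of_block x)) < \<delta> n}"
  have bound: "measure_pmf.prob (?R n) {x. \<bar>out_len \<beta> n x / real n - ?H\<bar> > \<epsilon>} \<le>
      measure_pmf.prob (?R n) (?dev n) + 1 / real n"
    if n: "n \<ge> 1" and r: "r n / real n < \<epsilon> / 2" for n
  proof -
    have "x \<in> ?dev n \<union> ?rare n"
      if x: "x \<in> set_pmf (?R n)" and far: "\<bar>out_len \<beta> n x / real n - ?H\<bar> > \<epsilon>" for x
    proof (rule ccontr)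
      assume no: "x \<notin> ?dev n \<union> ?rare n"
      then have "measure_pmf.prob (?R n) (type_cls n (type_of_block x)) \<ge> \<delta> n"
        using x set_replicate_pmf_subset_blocks by fastforce
      then have "\<bar>out_len \<beta> n x - ?I x\<bar> \<le> r n"
        unfolding r_def \<delta>_def by (rule out_len_near_self_information[OF n x])
      then have "\<bar>out_len \<beta> n x - ?I x\<bar> / real n \<le> r n / real n"
        by (rule divide_right_mono) simp
      also have "\<bar>out_len \<beta> n x - ?I x\<bar> / real n = \<bar>out_len \<beta> n x / real n - ?I x / real n\<bar>"
        by (simp add: diff_divide_distrib[symmetric])
      finally have "\<bar>out_len \<beta> n x / real n - ?I x / real n\<bar> \<le> r n / real n" .
      moreover have "\<bar>?I x / real n - ?H\<bar> \<le> \<epsilon> / 2"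
        using no by simp
      ultimately show False
        using far r by linarith
    qed
    then have "measure_pmf.prob (?R n) {x. \<bar>out_len \<beta> n x / real n - ?H\<bar> > \<epsilon>} \<le>
        measure_pmf.prob (?R n) (?dev n \<union> ?rare n)"
      by (intro measure_pmf.finite_measure_mono_AE) (auto simp: AE_measure_pmf_iff)
    also have "\<dots> \<le> measure_pmf.prob (?R n) (?dev n) + measure_pmf.prob (?R n) (?rare n)"
      by (rule measure_Un_le) simp_all
    also have "measure_pmf.prob (?R n) (?rare n) \<le> real (card (types n :: 'a pmf set)) * \<delta> n"
      by (rule prob_rare_type_le) (simp add: \<delta>_def)
    also have "\<dots> \<le> 2 ^ gamma_len CARD('a) n * \<delta> n"
      using card_types_le[OF n] by (intro mult_right_mono) (simp_all add: \<delta>_def)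
    also have "\<dots> = 1 / real n"
      by (simp add: \<delta>_def)
    finally show ?thesis
      by simp
  qed
  have "(\<lambda>n. measure_pmf.prob (?R n) (?dev n)) \<longlonglongrightarrow> 0"
    using weak_law_replicate_pmf[of p "\<lambda>a. - log 2 (pmf p a)"] half_gt_zero[OF \<epsilon>]
    unfolding p_lim_def source_entropy_eq_expectation by blast
  from tendsto_add[OF this lim_const_over_n[of 1]]
  have lim: "(\<lambda>n. measure_pmf.prob (?R n) (?dev n) + 1 / real n) \<longlonglongrightarrow> 0"
    by simp
  have ev: "\<forall>\<^sub>F n in sequentially. r n / real n < \<epsilon> / 2"
    using order_tendstoD(2)[OF overhead_rate_tendsto, of "\<epsilon> / 2"] \<epsilon> by (simp add: r_def)
  show "(\<lambda>n. measure_pmf.prob (?R n) {x. \<bar>out_len \<beta> n x / real n - ?H\<bar> > \<epsilon>}) \<longlonglongrightarrow> 0"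
  proof (rule tendsto_sandwich[OF _ _ tendsto_const lim])
    show "\<forall>\<^sub>F n in sequentially. measure_pmf.prob (?R n) {x. \<bar>out_len \<beta> n x / real n - ?H\<bar> > \<epsilon>} \<le>
        measure_pmf.prob (?R n) (?dev n) + 1 / real n"
      using ev eventually_ge_at_top[of 1] by eventually_elim (use bound in auto)
  qed simp
qed

subsection \<open>Uniformity of the output\<close>

text \<open>The two factors come from \<open>b / a \<le> 2 n\<^sup>\<beta> / n\<^sup>\<alpha>\<close> and \<open>b |T| / c \<ge> 1 - |T| / c \<ge> 1 - 1 / n\<^sup>\<beta>\<close>.\<close>

definition flatness :: "nat \<Rightarrow> real" where
  "flatness n = (1 + 2 * real n powr (\<beta> - \<alpha>)) / (1 - real n powr (- \<beta>))"

lemma flatness_tendsto: "flatness \<longlonglongrightarrow> 1"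
proof -
  have "(\<lambda>n::nat. real n powr (\<beta> - \<alpha>)) \<longlonglongrightarrow> 0" "(\<lambda>n::nat. real n powr (- \<beta>)) \<longlonglongrightarrow> 0"
    using \<alpha>_gt \<beta>_gt by (auto intro!: tendsto_neg_powr filterlim_real_sequentially)
  then have "(\<lambda>n. (1 + 2 * real n powr (\<beta> - \<alpha>)) / (1 - real n powr (- \<beta>))) \<longlonglongrightarrow> (1 + 2 * 0) / (1 - 0)"
    by (intro tendsto_intros) auto
  then show ?thesis
    by (simp add: flatness_def[abs_def])
qed

text \<open>With \<open>\<rho> = c / t\<close> the left side equals
  \<open>(1 + b / a) / (b / \<rho>) / c\<close>. The numerator is controlled by
  \<open>b \<le> \<rho>\<close> and \<open>a \<ge> n powr \<alpha>\<close>, the denominator by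
  \<open>b > \<rho> - 1\<close>, the loss from the floor.\<close>

lemma flatness_bound:
  fixes P :: "'a pmf"
  assumes n: "n \<ge> 2" and P: "P \<in> types n"
  shows "(real (a_size \<alpha> n) / real (b_size \<beta> n P) + 1) / real (a_size \<alpha> n) /
      real (card (type_cls n P)) \<le> flatness n / real (c_size \<beta> n P)"
proof -
  define a b c t where abct: "a = real (a_size \<alpha> n)" "b = real (b_size \<beta> n P)"
    "c = real (c_size \<beta> n P)" "t = real (card (type_cls n P))"
  define \<rho> where "\<rho> = c / t"
  have n1: "n \<ge> 1"
    using n by simp
  have t: "t > 0"
    using card_type_cls_pos[OF P] by (simp add: abct)
  have a: "a \<ge> real n powr \<alpha>"
    using a_size_ge[of \<alpha> n] n \<alpha>_gt \<beta>_gt by (simp add: abct)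
  \<comment> \<open>Strictness needs \<open>n \<ge> 2\<close>; it keeps the denominator of
    \<open>flatness\<close> positive.\<close>
  have na: "real n powr \<alpha> > 0" and nb: "real n powr \<beta> > 1"
    using n \<beta>_gt by auto
  with a have a_pos: "a > 0"
    by linarith
  have \<rho>: "real n powr \<beta> \<le> \<rho>" "\<rho> \<le> 2 * real n powr \<beta>"
    using c_size_bounds[OF n1 P] t by (simp_all add: \<rho>_def abct field_simps)
  have c_pos: "c > 0"
    by (simp add: abct c_size_def)
  have b: "b > \<rho> - 1" "b \<le> \<rho>"
    using b_size_pos[OF n1 P] unfolding \<rho>_def abct b_size_def by linarith+
  have b_pos: "b > 0"
    using b_size_pos[OF n1 P] by (simp add: abct)
  have "b / a \<le> 2 * real n powr \<beta> / real n powr \<alpha>"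
    using a b \<rho> na b_pos by (intro frac_le) auto
  also have "\<dots> = 2 * real n powr (\<beta> - \<alpha>)"
    by (simp add: powr_diff)
  finally have ba: "1 + b / a \<le> 1 + 2 * real n powr (\<beta> - \<alpha>)"
    by simp
  have "1 / \<rho> \<le> real n powr (- \<beta>)"
    unfolding powr_minus inverse_eq_divide using \<rho> nb n by (intro frac_le) auto
  moreover have "real n powr (- \<beta>) < 1"
    using nb by (simp add: powr_minus inverse_less_1_iff)
  moreover have "b / \<rho> \<ge> (\<rho> - 1) / \<rho>"
    using b \<rho> nb by (intro divide_right_mono) auto
  moreover have "(\<rho> - 1) / \<rho> = 1 - 1 / \<rho>"
    using \<rho> nb by (simp add: diff_divide_distrib)
  ultimately have "1 - real n powr (- \<beta>) \<le> b / \<rho>" "1 - real n powr (- \<beta>) > 0"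
    by linarith+
  then have "(1 + b / a) / (b / \<rho>) \<le> flatness n"
    unfolding flatness_def using ba b_pos a_pos by (intro frac_le) auto
  moreover have "(a / b + 1) / a / t = (1 + b / a) / (b / \<rho>) / c"
    using a_pos b_pos t c_pos by (simp add: \<rho>_def field_simps)
  ultimately have "(a / b + 1) / a / t \<le> flatness n / c"
    using c_pos by (metis divide_right_mono less_imp_le)
  then show ?thesis
    unfolding abct .
qed

text \<open>Given the type, an output fixes the block, the residue of the first seed and the second
  seed. By independence the probability is at most a product of the bounds for these events.\<close>

lemma prob_type_and_output_le:
  fixes p P :: "'a pmf"
  assumes n: "n \<ge> 2" and P: "P \<in> types n"
  shows "measure_pmf.prob (source_seed_pmf \<alpha> n p)
      {(y, u). type_of_block y = P \<and> encode \<beta> s k n y u = w}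
    \<le> flatness n / (real (c_size \<beta> n P) * 2 ^ gamma_len CARD('a) n) *
      measure_pmf.prob (replicate_pmf n p) (type_cls n P)"
proof -
  let ?R = "replicate_pmf n p" and ?T = "type_cls n P" and ?g = "gamma_len CARD('a) n"
  let ?t = "card ?T" and ?b = "b_size \<beta> n P" and ?a = "a_size \<alpha> n"
  have n1: "n \<ge> 1"
    using n by simp
  obtain i j where w: "w = (i, j)"
    by (cases w)
  \<comment> \<open>Euclidean division of \<open>i\<close> by the class size undoes the encoding:
    the remainder is the index of the block, the quotient the residue of the first seed.\<close>
  define Y where "Y = {y \<in> ?T. k n (s n P) y = i mod ?t}"
  define U where "U = {u. u mod ?b = i div ?t}"
  have sub: "y \<in> Y \<and> fst u \<in> U \<and> snd u = xor (s n P) j"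
    if y: "y \<in> ?T" and enc: "encode \<beta> s k n y u = w" for y u
  proof -
    have eq: "k n (s n P) y + (fst u mod ?b) * ?t = i" "xor (s n P) (snd u) = j"
      using that by (simp_all add: encode_def w Let_def v_idx_def type_cls_def)
    have "k n (s n P) y < ?t"
      using k_less[OF n1, of y] y by (auto simp: type_cls_def)
    then have "i mod ?t = k n (s n P) y" "i div ?t = fst u mod ?b"
      unfolding eq(1)[symmetric] by simp_all
    moreover have "snd u = xor (s n P) j"
      unfolding eq(2)[symmetric] by (simp flip: xor.assoc)
    ultimately show ?thesis
      using y by (simp add: Y_def U_def)
  qed
  \<comment> \<open>Injectivity of \<open>k\<close> leaves at most one block, which carries the
    fraction \<open>1 / ?t\<close> of its class.\<close>
  have prob_Y: "measure_pmf.prob ?R Y \<le> measure_pmf.prob ?R ?T / ?t"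
  proof (cases "Y = {}")
    case False
    then obtain y where y: "y \<in> Y"
      by auto
    then have "Y = {y}"
      using bij_betw_imp_inj_on[OF bij_k[OF n1 P]] by (auto simp: Y_def inj_on_def)
    moreover have "y \<in> blocks n" "type_of_block y = P"
      using y by (auto simp: Y_def type_cls_def)
    ultimately show ?thesis
      using prob_type_cls[of y n p] card_type_cls_pos[OF P] by (simp add: measure_pmf_single)
  qed simp
  have "real (card (seeds \<alpha> CARD('a) n \<inter> U \<times> {xor (s n P) j})) \<le> real (?a div ?b + 1)"
  proof -
    have "seeds \<alpha> CARD('a) n \<inter> U \<times> {xor (s n P) j} \<subseteq>
        {u. u < ?a \<and> u mod ?b = i div ?t} \<times> {xor (s n P) j}"
      by (auto simp: seeds_def U_def)
    then have "card (seeds \<alpha> CARD('a) n \<inter> U \<times> {xor (s n P) j}) \<le>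
        card ({u. u < ?a \<and> u mod ?b = i div ?t} \<times> {xor (s n P) j})"
      by (intro card_mono) auto
    also have "\<dots> \<le> ?a div ?b + 1"
      using card_mod_eq_le[OF b_size_pos[OF n1 P]] by (simp add: card_cartesian_product)
    finally show ?thesis
      by linarith
  qed
  also have "\<dots> \<le> real ?a / real ?b + 1"
    using of_nat_div_le_of_nat[of ?a ?b] by simp
  finally have prob_U: "measure_pmf.prob (pmf_of_set (seeds \<alpha> CARD('a) n)) (U \<times> {xor (s n P) j}) \<le>
      (real ?a / real ?b + 1) / (real ?a * 2 ^ ?g)"
    by (simp add: measure_pmf_of_set[OF seeds_nonempty finite_seeds] divide_right_mono)
       (simp add: seeds_def divide_right_mono)
  have "measure_pmf.prob (source_seed_pmf \<alpha> n p)
      {(y, u). type_of_block y = P \<and> encode \<beta> s k n y u = w} \<le>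
      measure_pmf.prob (source_seed_pmf \<alpha> n p) (Y \<times> (U \<times> {xor (s n P) j}))"
  \<comment> \<open>A type alone does not fix the length, so membership in the class is obtained on
    the support.\<close>
  proof (rule measure_pmf.finite_measure_mono_AE)
    show "AE z \<in> {(y, u). type_of_block y = P \<and> encode \<beta> s k n y u = w}
        in measure_pmf (source_seed_pmf \<alpha> n p). z \<in> Y \<times> (U \<times> {xor (s n P) j})"
      unfolding AE_measure_pmf_iff source_seed_pmf_def
    proof (intro ballI impI)
      fix z assume z: "z \<in> set_pmf (pair_pmf ?R (pmf_of_set (seeds \<alpha> CARD('a) n)))"
        "z \<in> {(y, u). type_of_block y = P \<and> encode \<beta> s k n y u = w}"
      then have "fst z \<in> ?T"
        using set_replicate_pmf_subset_blocks[of n p] by (auto simp: type_cls_def)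
      with sub[of "fst z" "snd z"] z(2) show "z \<in> Y \<times> (U \<times> {xor (s n P) j})"
        by (auto simp: mem_Times_iff)
    qed
  qed simp
  also have "\<dots> = measure_pmf.prob ?R Y *
      measure_pmf.prob (pmf_of_set (seeds \<alpha> CARD('a) n)) (U \<times> {xor (s n P) j})"
    unfolding source_seed_pmf_def by (rule measure_pmf_prob_product) auto
  also have "\<dots> \<le> (measure_pmf.prob ?R ?T / ?t) * ((real ?a / real ?b + 1) / (real ?a * 2 ^ ?g))"
    by (intro mult_mono prob_Y prob_U) auto
  also have "\<dots> = ((real ?a / real ?b + 1) / real ?a / real ?t) *
      (measure_pmf.prob ?R ?T / 2 ^ ?g)"
    by (simp add: ac_simps)
  also have "\<dots> \<le> (flatness n / real (c_size \<beta> n P)) * (measure_pmf.prob ?R ?T / 2 ^ ?g)"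
    by (intro mult_right_mono flatness_bound n P) auto
  finally show ?thesis
    by simp
qed

text \<open>The event of a given length splits into the types with the same \<open>c_size\<close>.
  The bound per type is summed over them and divided by the probability of that event.\<close>

lemma pmf_output_pmf_le:
  fixes p :: "'a pmf"
  assumes n: "n \<ge> 2" and x: "x \<in> set_pmf (replicate_pmf n p)"
  shows "pmf (output_pmf \<alpha> \<beta> s k n p x) w \<le> flatness n / real (card (outputs \<beta> n x))"
proof -
  let ?R = "replicate_pmf n p" and ?S = "source_seed_pmf \<alpha> n p"
  let ?g = "gamma_len CARD('a) n" and ?c = "c_size \<beta> n (type_of_block x)"
  let ?E = "{(y, u). out_len \<beta> n (y :: 'a list) = out_len \<beta> n x} :: ('a list \<times> nat \<times> nat) set"
  let ?f = "\<lambda>(y, u). encode \<beta> s k n y u"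
  let ?C = "{P \<in> types n. c_size \<beta> n P = ?c} :: 'a pmf set"
  let ?K = "flatness n / (real ?c * 2 ^ ?g)"
  have card: "real (card (outputs \<beta> n x)) = real ?c * 2 ^ ?g"
    by (simp add: outputs_def card_cartesian_product)
  obtain u where "u \<in> seeds \<alpha> CARD('a) n"
    using seeds_nonempty by blast
  then have "(x, u) \<in> set_pmf ?S \<inter> ?E"
    using x by (simp add: source_seed_pmf_def finite_seeds seeds_nonempty)
  then have ne: "set_pmf ?S \<inter> ?E \<noteq> {}"
    by blast
  then have E_pos: "measure_pmf.prob ?S ?E > 0"
    by (metis inf.commute measure_pmf_zero_iff zero_less_measure_iff)
  have blocks_S: "y \<in> blocks n" if "(y, u) \<in> set_pmf ?S" for y u
    using that set_replicate_pmf_subset_blocks by (auto simp: source_seed_pmf_def)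
  have "measure_pmf.prob ?S (?E \<inter> ?f -` {w}) \<le>
      measure_pmf.prob ?S (\<Union>P\<in>?C. {(y, u). type_of_block y = P \<and> encode \<beta> s k n y u = w})"
    by (rule measure_pmf.finite_measure_mono_AE)
       (auto simp: AE_measure_pmf_iff out_len_eq_iff_c_size_eq type_of_block_in_types dest: blocks_S)
  also have "\<dots> \<le> (\<Sum>P\<in>?C. measure_pmf.prob ?S {(y, u). type_of_block y = P \<and> encode \<beta> s k n y u = w})"
    by (rule measure_pmf.finite_measure_subadditive_finite) (auto simp: finite_types)
  \<comment> \<open>\<open>?K\<close> depends on a type only through its \<open>c_size\<close>,
    which is \<open>?c\<close> throughout \<open>?C\<close>, so one constant serves all types being
    mixed.\<close>
  also have "\<dots> \<le> (\<Sum>P\<in>?C. ?K * measure_pmf.prob ?R (type_cls n P))"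
  proof (rule sum_mono)
    fix P assume "P \<in> ?C"
    then show "measure_pmf.prob ?S {(y, u). type_of_block y = P \<and> encode \<beta> s k n y u = w} \<le>
        ?K * measure_pmf.prob ?R (type_cls n P)"
      using prob_type_and_output_le[OF n, of P p w] by simp
  qed
  also have "\<dots> = ?K * measure_pmf.prob ?R (\<Union>P\<in>?C. type_cls n P)"
    by (subst measure_pmf.finite_measure_finite_Union)
       (auto simp: finite_types sum_distrib_left disjoint_family_on_def type_cls_def)
  also have "measure_pmf.prob ?R (\<Union>P\<in>?C. type_cls n P) = measure_pmf.prob ?R {y. out_len \<beta> n y = out_len \<beta> n x}"
    using set_replicate_pmf_subset_blocks
    by (intro measure_pmf.finite_measure_eq_AE)
       (auto simp: AE_measure_pmf_iff out_len_eq_iff_c_size_eq type_cls_def intro: type_of_block_in_types)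
  also have "\<dots> = measure_pmf.prob ?S ?E"
  proof -
    have "?R = map_pmf fst ?S"
      by (simp add: source_seed_pmf_def map_fst_pair_pmf)
    then have "measure_pmf.prob ?R {y. out_len \<beta> n y = out_len \<beta> n x} =
        measure_pmf.prob ?S (fst -` {y. out_len \<beta> n y = out_len \<beta> n x})"
      by (metis measure_map_pmf)
    also have "fst -` {y. out_len \<beta> n y = out_len \<beta> n x} = ?E"
      by auto
    finally show ?thesis .
  qed
  finally have joint: "measure_pmf.prob ?S (?E \<inter> ?f -` {w}) \<le> ?K * measure_pmf.prob ?S ?E" .
  have "pmf (output_pmf \<alpha> \<beta> s k n p x) w = measure_pmf.prob (cond_pmf ?S ?E) (?f -` {w})"
    by (simp add: output_pmf_def pmf_map)
  also have "\<dots> = measure_pmf.prob ?S (?E \<inter> ?f -` {w}) / measure_pmf.prob ?S ?E"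
    unfolding cond_pmf.rep_eq[OF ne] using E_pos
    by (subst measure_uniform_measure) (auto simp: measure_pmf.emeasure_eq_measure)
  also have "\<dots> \<le> ?K"
    using joint E_pos by (simp add: divide_le_eq)
  finally show ?thesis
    by (simp add: card)
qed

text \<open>Blocks of equal output length share the set \<open>outputs\<close>, so conditioning on
  the length stays inside it. This supplies the absolute continuity that the divergence bound
  requires.\<close>

lemma set_output_pmf_subset:
  fixes p :: "'a pmf"
  assumes n: "n \<ge> 1" and x: "x \<in> set_pmf (replicate_pmf n p)"
  shows "set_pmf (output_pmf \<alpha> \<beta> s k n p x) \<subseteq> outputs \<beta> n x"
proof -
  let ?S = "source_seed_pmf \<alpha> n p"
  let ?E = "{(y, u). out_len \<beta> n (y :: 'a list) = out_len \<beta> n x} :: ('a list \<times> nat \<times> nat) set"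
  have S: "set_pmf ?S = set_pmf (replicate_pmf n p) \<times> seeds \<alpha> CARD('a) n"
    by (simp add: source_seed_pmf_def finite_seeds seeds_nonempty)
  have "set_pmf ?S \<inter> ?E \<noteq> {}"
    using x seeds_nonempty unfolding S by auto
  then have set: "set_pmf (output_pmf \<alpha> \<beta> s k n p x) = (\<lambda>(y, u). encode \<beta> s k n y u) ` (set_pmf ?S \<inter> ?E)"
    by (simp add: output_pmf_def)
  have "encode \<beta> s k n y u \<in> outputs \<beta> n x"
    if "y \<in> set_pmf (replicate_pmf n p)" "u \<in> seeds \<alpha> CARD('a) n" "out_len \<beta> n y = out_len \<beta> n x" for y u
  proof -
    have "outputs \<beta> n y = outputs \<beta> n x"
      using that(3) by (simp add: out_len_eq_iff_c_size_eq outputs_def)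
    then show ?thesis
      using encode_in_outputs[OF n, of y u] that set_replicate_pmf_subset_blocks by blast
  qed
  then show ?thesis
    unfolding set S by auto
qed

lemma output_divergence_bounds:
  fixes p :: "'a pmf"
  assumes n: "n \<ge> 2" and x: "x \<in> set_pmf (replicate_pmf n p)"
  shows "0 \<le> output_divergence \<alpha> \<beta> s k n p x" "output_divergence \<alpha> \<beta> s k n p x \<le> log 2 (flatness n)"
proof -
  have "finite (outputs \<beta> n x)"
    by (simp add: outputs_def)
  moreover have "set_pmf (output_pmf \<alpha> \<beta> s k n p x) \<subseteq> outputs \<beta> n x"
    using set_output_pmf_subset n x by simp
  ultimately show "0 \<le> output_divergence \<alpha> \<beta> s k n p x"
    "output_divergence \<alpha> \<beta> s k n p x \<le> log 2 (flatness n)"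
    unfolding output_divergence_def
    using KL_divergence_pmf_of_set_bounds pmf_output_pmf_le[OF n x] by blast+
qed

text \<open>The bound \<open>log 2 (flatness n)\<close> is the same for every realization and thus
  survives the supremum.\<close>

lemma output_divergence_tendsto:
  fixes p :: "'a pmf"
  shows "(\<lambda>n. SUP x\<in>set_pmf (replicate_pmf n p). output_divergence \<alpha> \<beta> s k n p x) \<longlonglongrightarrow> 0"
proof (rule tendsto_sandwich[OF _ _ tendsto_const])
  let ?D = "\<lambda>n. SUP x\<in>set_pmf (replicate_pmf n p). output_divergence \<alpha> \<beta> s k n p x"
  have "(\<lambda>n. log 2 (flatness n)) \<longlonglongrightarrow> log 2 1"
    by (intro tendsto_intros flatness_tendsto) auto
  then show "(\<lambda>n. log 2 (flatness n)) \<longlonglongrightarrow> 0"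
    by simp
  have "0 \<le> ?D n \<and> ?D n \<le> log 2 (flatness n)" if n: "n \<ge> 2" for n
  proof -
    obtain x where x: "x \<in> set_pmf (replicate_pmf n p)"
      using set_pmf_not_empty by fast
    \<comment> \<open>A real supremum dominates its members only if the set is bounded
      above.\<close>
    have "bdd_above (output_divergence \<alpha> \<beta> s k n p ` set_pmf (replicate_pmf n p))"
      using output_divergence_bounds(2)[OF n] by (auto intro!: bdd_aboveI2)
    then have "output_divergence \<alpha> \<beta> s k n p x \<le> ?D n"
      using x by (intro cSUP_upper)
    moreover have "?D n \<le> log 2 (flatness n)"
      using output_divergence_bounds(2)[OF n] by (intro cSUP_least set_pmf_not_empty)
    ultimately show ?thesis
      using output_divergence_bounds(1)[OF n x] by simp
  qed
  then show "\<forall>\<^sub>F n in sequentially. 0 \<le> ?D n" "\<forall>\<^sub>F n in sequentially. ?D n \<le> log 2 (flatness n)"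
    by (auto intro!: eventually_sequentiallyI[of 2])
qed

end

theorem theorem1:
  fixes \<alpha> \<beta> :: real
    and s :: "nat \<Rightarrow> 'a::finite pmf \<Rightarrow> nat"
    and k :: "nat \<Rightarrow> nat \<Rightarrow> 'a list \<Rightarrow> nat"
  assumes "\<alpha> > \<beta>" and "\<beta> > 1"
    and "\<And>n. n \<ge> 1 \<Longrightarrow> inj_on (s n) (types n)"
    and "\<And>n. n \<ge> 1 \<Longrightarrow> s n ` types n \<subseteq> {..<2 ^ gamma_len CARD('a) n}"
    and "\<And>n P. n \<ge> 1 \<Longrightarrow> P \<in> types n \<Longrightarrow>
           bij_betw (k n (s n P)) (type_cls n P) {..<card (type_cls n P)}"
  shows "(\<forall>n\<ge>1. uniform_source_code n (seed_len \<alpha> CARD('a) n) (seeds \<alpha> CARD('a) n)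
            (out_len \<beta> n) (outputs \<beta> n) (encode \<beta> s k n) (decode \<beta> s k n)) \<and>
    (\<forall>p :: 'a pmf.
       (\<exists>L. p_lim (\<lambda>n. replicate_pmf n p) (\<lambda>n x. out_len \<beta> n x / real n) L \<and>
            L \<le> source_entropy p) \<and>
       liminf (\<lambda>n. ereal (real (seed_len \<alpha> CARD('a) n) / log 2 (real n))) > 0 \<and>
       limsup (\<lambda>n. ereal (real (seed_len \<alpha> CARD('a) n) / log 2 (real n))) < \<infinity> \<and>
       (\<forall>n\<ge>1. measure_pmf.prob (source_seed_pmf \<alpha> n p)
            {(x, u). x \<noteq> decode \<beta> s k n (encode \<beta> s k n x u) u} = 0) \<and>
       (\<lambda>n. SUP x\<in>set_pmf (replicate_pmf n p). output_divergence \<alpha> \<beta> s k n p x) \<longlonglongrightarrow> 0)"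
proof -
  interpret type_scheme \<alpha> \<beta> s k
    by (rule type_scheme.intro) (use assms in auto)
  have lim: "(\<lambda>n. ereal (real (seed_len \<alpha> CARD('a) n) / log 2 (real n))) \<longlonglongrightarrow> ereal (real CARD('a) + \<alpha>)"
    using seed_len_over_log_tendsto[of \<alpha> "CARD('a)"] assms(1,2) by simp
  have "liminf (\<lambda>n. ereal (real (seed_len \<alpha> CARD('a) n) / log 2 (real n))) = ereal (real CARD('a) + \<alpha>)"
    "limsup (\<lambda>n. ereal (real (seed_len \<alpha> CARD('a) n) / log 2 (real n))) = ereal (real CARD('a) + \<alpha>)"
    using lim_imp_Liminf[OF _ lim] lim_imp_Limsup[OF _ lim] by simp_all
  moreover have "real CARD('a) + \<alpha> > 0"
    using assms(1,2) by (simp add: add_nonneg_pos)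
  \<comment> \<open>The witness is the entropy itself, so the inequality holds with
    equality.\<close>
  moreover have "\<exists>L. p_lim (\<lambda>n. replicate_pmf n p) (\<lambda>n x. out_len \<beta> n x / real n) L \<and> L \<le> source_entropy p"
    for p :: "'a pmf"
    using out_len_rate_p_lim by blast
  ultimately show ?thesis
    using uniform_source_code decoding_error_prob output_divergence_tendsto by simp
qed

end
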